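(* Let $N\ge 2$ be an integer, let $V>g>0$ be real numbers, and let $r_1,r_2\in[0,1]$ with at least one of $r_1,r_2$ nonzero. Let $p^*=\left(\frac{r_1g}{V-g+r_1g}\right)^{\frac{1}{N-1}}$. Under the symmetric mixed-strategy Nash equilibrium of the auction game: (1) The expected number of submitted transactions is $$\mathbb E[\mathsf{SubmittedTXs}]=(1-p^* )N=\left(1-\left(\frac{r_1g}{V-g+r_1g}\right)^{\frac1{N-1}}\right)N.$$ (2) With the other parameters fixed, the expected number of submitted transactions decreases in $r_1$ and does not depend on $r_2$. (3) If $r_1\neq0$, then as $N\to\infty$ (with the other parameters fixed), the expected number of submitted transactions converges to a finite limit, with $$\lim_{N\to\infty}\mathbb E[\mathsf{SubmittedTXs}]=\log\left(1+\frac{V-g}{r_1g}\right).$$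
   Context: Auction game. $N\ge2$ agents compete for a single opportunity of common value $V>0$; $g>0$ is the base fee, with $V>g$; $r_1,r_2\in[0,1]$ are the revert penalty rates on the base fee and the priority fee. Each agent either abstains or submits a priority-fee bid $b_i\ge0$. The highest participating bidder $w$ wins, receives value $V$ and pays $g+b_w$; every other participating agent $j$ receives no value and pays $r_1g+r_2b_j$; abstaining agents receive and pay nothing. A mixed strategy is a pair $(p,F)$: abstain with probability $p\in[0,1]$, otherwise draw the bid from the continuous cdf $F$ on $[0,\infty)$; agents randomize independently and maximize expected payoff (value received minus payment). When at least one of $r_1,r_2$ is nonzero, the (unique) symmetric mixed-strategy Nash equilibrium is the profile in which every agent uses $(p^*,F^* )$, with $p^*$ as in the claim and $$F^*(b)=\frac{1}{1-p^*}\left(\left(\frac{r_1g+r_2b}{V-g-b+r_1g+r_2b}\right)^{\frac1{N-1}}-p^*\right),\quad b\in[0,V-g].$$ $\mathsf{SubmittedTXs}$ is the (random) number of agents who participate, i.e. do not abstain; the expectation is over the equilibrium randomization. *)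

theory Defs
  imports "HOL-Probability.Probability"
begin

text \<open>An action is a pair: whether the agent participates, and its priority-fee bid.
  The bid of an abstaining agent is never looked at.\<close>

type_synonym action = "bool \<times> real"

abbreviation participates :: "action \<Rightarrow> bool" where
  "participates a \<equiv> fst a"

abbreviation bid :: "action \<Rightarrow> real" where
  "bid a \<equiv> snd a"

text \<open>The agents are the numbers below \<open>N\<close>. Ties are broken in favour of the smaller index,
  so that there is exactly one winner as soon as someone participates; ties between
  participants have probability zero under the mixed strategies below.\<close>

definition wins :: "nat \<Rightarrow> (nat \<Rightarrow> action) \<Rightarrow> nat \<Rightarrow> bool" where
  "wins N a i \<longleftrightarrow> participates (a i) \<and>
     (\<forall>j<N. j \<noteq> i \<and> participates (a j) \<longrightarrow>
        bid (a j) < bid (a i) \<or> bid (a j) = bid (a i) \<and> i < j)"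

definition received :: "nat \<Rightarrow> real \<Rightarrow> (nat \<Rightarrow> action) \<Rightarrow> nat \<Rightarrow> real" where
  "received N V a i = (if wins N a i then V else 0)"

definition payment ::
  "nat \<Rightarrow> real \<Rightarrow> real \<Rightarrow> real \<Rightarrow> (nat \<Rightarrow> action) \<Rightarrow> nat \<Rightarrow> real" where
  "payment N g r1 r2 a i =
     (if wins N a i then g + bid (a i)
      else if participates (a i) then r1 * g + r2 * bid (a i)
      else 0)"

text \<open>A mixed strategy \<open>(p, F)\<close>: abstention probability and bid distribution function. The
  distribution function lives on the whole line; being continuous there and zero on the
  negative half-line, it has no atom at \<open>0\<close> either.\<close>

type_synonym strategy = "real \<times> (real \<Rightarrow> real)"

definition mixed_strategy :: "strategy \<Rightarrow> bool" where
  "mixed_strategy s \<longleftrightarrow> (case s of (p, F) \<Rightarrow>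
     p \<in> {0..1} \<and> mono F \<and> continuous_on UNIV F \<and> (\<forall>b<0. F b = 0) \<and> (F \<longlongrightarrow> 1) at_top)"

definition action_measure :: "strategy \<Rightarrow> action measure" where
  "action_measure s = (case s of (p, F) \<Rightarrow>
     measure_pmf (bernoulli_pmf (1 - p)) \<Otimes>\<^sub>M interval_measure F)"

definition play :: "nat \<Rightarrow> (nat \<Rightarrow> strategy) \<Rightarrow> (nat \<Rightarrow> action) measure" where
  "play N \<sigma> = (\<Pi>\<^sub>M i\<in>{..<N}. action_measure (\<sigma> i))"

text \<open>The expected payoff is extended-real valued: the value received is bounded, but the expected
  payment is infinite for some heavy-tailed bid distributions. A Bochner integral would silently
  give such strategies payoff \<open>0\<close> instead of \<open>-\<infinity>\<close>.\<close>

definition expected_payoff ::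
  "nat \<Rightarrow> real \<Rightarrow> real \<Rightarrow> real \<Rightarrow> real \<Rightarrow> (nat \<Rightarrow> strategy) \<Rightarrow> nat \<Rightarrow> ereal" where
  "expected_payoff N V g r1 r2 \<sigma> i =
     enn2ereal (\<integral>\<^sup>+ a. ennreal (received N V a i) \<partial>play N \<sigma>)
     - enn2ereal (\<integral>\<^sup>+ a. ennreal (payment N g r1 r2 a i) \<partial>play N \<sigma>)"

definition nash_equilibrium ::
  "nat \<Rightarrow> real \<Rightarrow> real \<Rightarrow> real \<Rightarrow> real \<Rightarrow> (nat \<Rightarrow> strategy) \<Rightarrow> bool" where
  "nash_equilibrium N V g r1 r2 \<sigma> \<longleftrightarrow>
     (\<forall>i<N. mixed_strategy (\<sigma> i) \<and>
        (\<forall>s. mixed_strategy s \<longrightarrow>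
           expected_payoff N V g r1 r2 (\<sigma>(i := s)) i \<le> expected_payoff N V g r1 r2 \<sigma> i))"

definition equilibrium_strategy ::
  "nat \<Rightarrow> real \<Rightarrow> real \<Rightarrow> real \<Rightarrow> real \<Rightarrow> strategy" where
  "equilibrium_strategy N V g r1 r2 = (THE s. nash_equilibrium N V g r1 r2 (\<lambda>_. s))"

definition submitted_txs :: "nat \<Rightarrow> (nat \<Rightarrow> action) \<Rightarrow> nat" where
  "submitted_txs N a = card {i. i < N \<and> participates (a i)}"

definition expected_submitted ::
  "nat \<Rightarrow> real \<Rightarrow> real \<Rightarrow> real \<Rightarrow> real \<Rightarrow> real" where
  "expected_submitted N V g r1 r2 =
     (\<integral>a. real (submitted_txs N a) \<partial>play N (\<lambda>_. equilibrium_strategy N V g r1 r2))"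

definition p_star :: "nat \<Rightarrow> real \<Rightarrow> real \<Rightarrow> real \<Rightarrow> real" where
  "p_star N V g r1 = (r1 * g / (V - g + r1 * g)) powr (1 / (real N - 1))"

end

theory Submission
  imports Defs "HOL-Real_Asymp.Real_Asymp"
begin

text \<open>If all opponents use \<open>(p, F)\<close>, a bid \<open>b\<close> wins with probability
  \<open>G b = (p + (1 - p) * F b) ^ (N - 1)\<close> and is worth
  \<open>G b * (V - g - b) - (1 - G b) * (r1 * g + r2 * b)\<close>. In a symmetric equilibrium no bid is worth
  more than the equilibrium payoff, since narrow uniform distributions are available as deviations,
  and \<open>F\<close>-almost every bid is worth exactly that much. Continuity of \<open>F\<close> and the absence
  of gaps in the support extend this to every \<open>b \<ge> 0\<close> with \<open>F b < 1\<close>, in particular to \<open>b = 0\<close>;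
  there it forces the payoff to be \<open>0\<close> and \<open>p\<close> to be \<open>p_star\<close>. Solving for \<open>F\<close> gives
  uniqueness, and the same formula shows that the resulting pair is an equilibrium. The number of
  submitted transactions then has mean \<open>(1 - p_star) * N\<close>.\<close>

section \<open>Elementary inequalities and the limit behind part (3)\<close>

text \<open>Cross-multiplying leaves \<open>x * y\<close> on both sides, where it cancels.
  \<open>bid_ratio\<close> and the base of \<open>p_star\<close> both have the shape
  \<open>x / (c + x)\<close>.\<close>

lemma
  fixes x y c d :: real
  assumes "0 < c + x" "0 < d + y"
  shows divide_add_self_le_iff: "x / (c + x) \<le> y / (d + y) \<longleftrightarrow> x * d \<le> y * c"
    and divide_add_self_less_iff: "x / (c + x) < y / (d + y) \<longleftrightarrow> x * d < y * c"
  using assms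
  by (simp_all add: pos_divide_le_eq pos_le_divide_eq pos_divide_less_eq pos_less_divide_eq
      algebra_simps)

text \<open>Lets the symmetric profile itself be read as a trivial deviation, so that payoff
  formulas for deviations apply to it.\<close>

lemma const_fun_upd: "(\<lambda>_. c)(i := c) = (\<lambda>_. c)"
  by (rule ext) simp

text \<open>The function \<open>x powr t\<close> has derivative \<open>ln x\<close> at
  \<open>t = 0\<close>. Here \<open>t\<close> runs through \<open>h n = 1 / (n - 1)\<close>, and
  replacing the factor \<open>n\<close> by \<open>1 / h n\<close> is harmless because
  \<open>h n * n\<close> tends to \<open>1\<close>.\<close>

lemma tendsto_one_minus_powr_mult:
  fixes x :: real
  assumes "0 < x"
  shows "(\<lambda>n. (1 - x powr (1 / (real n - 1))) * real n) \<longlonglongrightarrow> - ln x"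
proof -
  define h where "h n = 1 / (real n - 1)" for n :: nat
  have "((\<lambda>t. x powr t) has_real_derivative x powr 0 * ln x) (at 0)"
    using assms by (auto intro!: derivative_eq_intros)
  then have "((\<lambda>t. (x powr t - 1) / t) \<longlongrightarrow> ln x) (at 0)"
    using assms by (simp add: has_field_derivative_iff)
  moreover have "filterlim h (at 0) sequentially"
    unfolding h_def by real_asymp
  ultimately have "(\<lambda>n. (x powr h n - 1) / h n) \<longlonglongrightarrow> ln x"
    by (rule filterlim_compose)
  moreover have "(\<lambda>n. h n * real n) \<longlonglongrightarrow> 1"
    unfolding h_def by real_asymp
  ultimately have "(\<lambda>n. - ((x powr h n - 1) / h n * (h n * real n))) \<longlonglongrightarrow> - (ln x * 1)"
    by (intro tendsto_intros)
  moreover have "\<forall>\<^sub>F n in sequentially.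
      - ((x powr h n - 1) / h n * (h n * real n)) = (1 - x powr (1 / (real n - 1))) * real n"
    using eventually_gt_at_top[of 1] by eventually_elim (simp add: h_def field_simps)
  ultimately show ?thesis
    using Lim_transform_eventually by force
qed

subsection \<open>Mixed strategies\<close>

lemma mixed_strategyD:
  assumes "mixed_strategy (p, F)"
  shows "0 \<le> p" "p \<le> 1" "mono F" "continuous_on UNIV F" "\<And>b. b < 0 \<Longrightarrow> F b = 0"
    "(F \<longlongrightarrow> 1) at_top"
  using assms by (auto simp: mixed_strategy_def)

text \<open>Continuity at \<open>0\<close> turns the left limit \<open>0\<close> into the value
  there. The lower bound follows by monotonicity, the upper one from the limit at infinity.\<close>

lemma
  assumes "mixed_strategy (p, F)"
  shows mixed_strategy_cdf_nonpos: "b \<le> 0 \<Longrightarrow> F b = 0"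
    and mixed_strategy_cdf_nonneg: "0 \<le> F b"
    and mixed_strategy_cdf_le_1: "F b \<le> 1"
proof -
  note F = mixed_strategyD[OF assms]
  have "isCont F 0"
    using F(4) by (simp add: continuous_on_eq_continuous_at)
  then have "(F \<longlongrightarrow> F 0) (at_left 0)"
    by (simp add: isCont_def filterlim_at_split)
  moreover have "(F \<longlongrightarrow> 0) (at_left 0)"
    by (rule tendsto_eventually)
      (use F(5) in \<open>auto simp: eventually_at_filter\<close>)
  ultimately have zero: "F 0 = 0"
    using tendsto_unique trivial_limit_at_left_real by blast
  show *: "b \<le> 0 \<Longrightarrow> F b = 0" for b
    using F(5)[of b] zero by (cases "b = 0") auto
  show "0 \<le> F b"
    using *[of b] monoD[OF F(3), of 0 b] zero by (cases "b \<le> 0") auto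
  show "F b \<le> 1"
  proof (rule tendsto_lowerbound[OF F(6)])
    show "\<forall>\<^sub>F x in at_top. F b \<le> F x"
      using eventually_ge_at_top[of b] by eventually_elim (simp add: monoD[OF F(3)])
  qed simp
qed

lemma mixed_strategy_cdf_right_continuous:
  "mixed_strategy (p, F) \<Longrightarrow> continuous (at_right a) F"
  using mixed_strategyD(4) continuous_on_eq_continuous_at[OF open_UNIV, of F]
  by (auto intro: continuous_at_imp_continuous_within)

lemma real_distribution_bid:
  assumes "mixed_strategy (p, F)"
  shows "real_distribution (interval_measure F)"
proof (rule real_distribution_interval_measure)
  show "(F \<longlongrightarrow> 0) at_bot"
    by (rule tendsto_eventually)
      (use eventually_le_at_bot[of "0::real"] in eventually_elim,
        simp add: mixed_strategy_cdf_nonpos[OF assms])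
qed (use assms mixed_strategyD[OF assms] mixed_strategy_cdf_right_continuous in
  \<open>auto simp: monoD\<close>)

lemma prob_space_bid: "mixed_strategy (p, F) \<Longrightarrow> prob_space (interval_measure F)"
  using real_distribution_bid by (simp add: real_distribution_def)

lemma emeasure_bid_atLeastAtMost:
  assumes "mixed_strategy (p, F)" "a \<le> b"
  shows "emeasure (interval_measure F) {a..b} = ennreal (F b - F a)"
  using mixed_strategyD[OF assms(1)] assms(2)
  by (subst emeasure_interval_measure_Icc) (auto simp: monoD)

text \<open>Absence of atoms: a singleton has mass \<open>F b - F b\<close>. Ties and endpoints of
  intervals can thus be neglected.\<close>

lemma AE_bid_neq:
  assumes "mixed_strategy (p, F)"
  shows "AE x in interval_measure F. x \<noteq> b"
  using emeasure_bid_atLeastAtMost[OF assms, of b b]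
  by (intro AE_I[of _ _ "{b}"]) auto

lemma emeasure_bid_atMost:
  assumes "mixed_strategy (p, F)"
  shows "emeasure (interval_measure F) {..b} = ennreal (F b)"
proof -
  interpret real_distribution "interval_measure F"
    by (rule real_distribution_bid[OF assms])
  note F = mixed_strategyD[OF assms]
  have "cdf (interval_measure F) = F"
  proof (rule cdf_interval_measure)
    show "(F \<longlongrightarrow> 0) at_bot"
      by (rule tendsto_eventually)
        (use eventually_le_at_bot[of "0::real"] in eventually_elim,
          simp add: mixed_strategy_cdf_nonpos[OF assms])
  qed (use assms F mixed_strategy_cdf_right_continuous in \<open>auto simp: monoD\<close>)
  then show ?thesis
    by (metis cdf_def emeasure_eq_measure)
qed

lemma emeasure_bid_lessThan:
  assumes "mixed_strategy (p, F)"
  shows "emeasure (interval_measure F) {..<b} = ennreal (F b)"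
proof -
  have "emeasure (interval_measure F) {..<b} = emeasure (interval_measure F) {..b}"
    using AE_bid_neq[OF assms, of b] by (intro emeasure_eq_AE) auto
  then show ?thesis
    by (simp add: emeasure_bid_atMost[OF assms])
qed

lemma AE_bid_ge:
  assumes "mixed_strategy (p, F)" "F b = 0"
  shows "AE x in interval_measure F. b \<le> x"
  using emeasure_bid_lessThan[OF assms(1), of b] assms(2)
  by (intro AE_I[of _ _ "{..<b}"]) auto

lemma AE_bid_nonneg: "mixed_strategy (p, F) \<Longrightarrow> AE x in interval_measure F. 0 \<le> x"
  using AE_bid_ge mixed_strategy_cdf_nonpos by blast

lemma AE_bid_le:
  assumes "mixed_strategy (p, F)" "F b = 1"
  shows "AE x in interval_measure F. x \<le> b"
proof -
  interpret prob_space "interval_measure F"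
    by (rule prob_space_bid[OF assms(1)])
  have "prob {..b} = 1"
    using emeasure_bid_atMost[OF assms(1), of b] assms(2) by (simp add: emeasure_eq_measure)
  then show ?thesis
    using AE_in_set_eq_1[of "{..b}"] by simp
qed

section \<open>The law of a single action\<close>

text \<open>The sigma-algebra does not depend on the strategy, so measurability can be checked once
  for all profiles.\<close>

lemma sets_action_measure [measurable_cong]:
  "sets (action_measure s) = sets (count_space UNIV \<Otimes>\<^sub>M borel)"
  by (cases s) (auto simp: action_measure_def intro!: sets_pair_measure_cong)

lemma space_action_measure [simp]: "space (action_measure s) = UNIV"
  using sets_eq_imp_space_eq[OF sets_action_measure[of s]] by (simp add: space_pair_measure)

lemma prob_space_action_measure:
  assumes "mixed_strategy s"
  shows "prob_space (action_measure s)"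
proof (cases s)
  case (Pair p F)
  interpret B: prob_space "interval_measure F"
    using assms Pair prob_space_bid by blast
  interpret P: pair_prob_space "measure_pmf (bernoulli_pmf (1 - p))" "interval_measure F" ..
  show ?thesis
    using P.prob_space_axioms by (simp add: action_measure_def Pair)
qed

lemma nn_integral_action_measure:
  assumes s: "mixed_strategy (p, F)"
    and [measurable]: "f \<in> borel_measurable (count_space UNIV \<Otimes>\<^sub>M borel)"
  shows "(\<integral>\<^sup>+ a. f a \<partial>action_measure (p, F)) =
    ennreal (1 - p) * (\<integral>\<^sup>+ b. f (True, b) \<partial>interval_measure F) +
    ennreal p * (\<integral>\<^sup>+ b. f (False, b) \<partial>interval_measure F)"
proof -
  interpret B: prob_space "interval_measure F"
    using s prob_space_bid by blast
  have "(\<integral>\<^sup>+ a. f a \<partial>action_measure (p, F)) =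
    (\<integral>\<^sup>+ x. \<integral>\<^sup>+ b. f (x, b) \<partial>interval_measure F \<partial>bernoulli_pmf (1 - p))"
    by (subst B.nn_integral_fst) (simp_all add: action_measure_def)
  then show ?thesis
    using mixed_strategyD(1,2)[OF s] by (simp add: mult.commute)
qed

text \<open>These are the actions that do not beat a bid \<open>b\<close>. Tie-breaking calls for
  both kinds of half-line; they have equal mass because \<open>F\<close> has no atoms.\<close>

lemma emeasure_action_measure_losing:
  assumes s: "mixed_strategy (p, F)" and B: "B = {..b} \<or> B = {..<b}"
  shows "{a. participates a \<longrightarrow> bid a \<in> B} \<in> sets (action_measure (p, F))"
    and "emeasure (action_measure (p, F)) {a. participates a \<longrightarrow> bid a \<in> B} =
      ennreal (p + (1 - p) * F b)"
proof -
  have [measurable]: "B \<in> sets borel"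
    using B by auto
  have "Measurable.pred (count_space UNIV \<Otimes>\<^sub>M (borel :: real measure))
      (\<lambda>a. participates a \<longrightarrow> bid a \<in> B)"
    by measurable
  then have S: "{a. participates a \<longrightarrow> bid a \<in> B} \<in> sets (count_space UNIV \<Otimes>\<^sub>M (borel :: real measure))"
    by (simp add: pred_def space_pair_measure)
  then show "{a. participates a \<longrightarrow> bid a \<in> B} \<in> sets (action_measure (p, F))"
    by (simp add: sets_action_measure)
  then have "emeasure (action_measure (p, F)) {a. participates a \<longrightarrow> bid a \<in> B} =
      (\<integral>\<^sup>+ a. indicator {a. participates a \<longrightarrow> bid a \<in> B} a \<partial>action_measure (p, F))"
    by simp
  also have "\<dots> = ennreal (1 - p) * (\<integral>\<^sup>+ b. indicator B b \<partial>interval_measure F) +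
     ennreal p * (\<integral>\<^sup>+ b. 1 \<partial>interval_measure F)"
    using S by (subst nn_integral_action_measure[OF s])
      (auto intro!: arg_cong2[of _ _ _ _ "(+)"] arg_cong2[of _ _ _ _ "(*)"] nn_integral_cong
        split: split_indicator simp del: nn_integral_indicator nn_integral_const)
  also have "\<dots> = ennreal (1 - p) * ennreal (F b) + ennreal p"
    using B emeasure_bid_atMost[OF s] emeasure_bid_lessThan[OF s]
      prob_space.emeasure_space_1[OF prob_space_bid[OF s]]
    by auto
  also have "\<dots> = ennreal (p + (1 - p) * F b)"
    using mixed_strategyD(1,2)[OF s] mixed_strategy_cdf_nonneg[OF s, of b]
    by (simp add: ennreal_mult[symmetric] ennreal_plus[symmetric] add.commute del: ennreal_plus)
  finally show "emeasure (action_measure (p, F)) {a. participates a \<longrightarrow> bid a \<in> B} =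
      ennreal (p + (1 - p) * F b)" .
qed

text \<open>A pure bid is not a mixed strategy, since its distribution function jumps; the uniform
  law on a short interval stands in for it.\<close>

definition uniform_cdf :: "real \<Rightarrow> real \<Rightarrow> real \<Rightarrow> real" where
  "uniform_cdf a b x = max 0 (min 1 ((x - a) / (b - a)))"

lemma mixed_strategy_uniform:
  assumes "0 \<le> a" "a < b"
  shows "mixed_strategy (0, uniform_cdf a b)"
proof -
  have "mono (uniform_cdf a b)"
    unfolding uniform_cdf_def using assms
    by (intro monoI max.mono min.mono divide_right_mono order_refl) auto
  moreover have "continuous_on UNIV (uniform_cdf a b)"
    unfolding uniform_cdf_def using assms by (intro continuous_intros) auto
  moreover have "uniform_cdf a b x = 0" if "x < 0" for x
    using that assms by (simp add: uniform_cdf_def divide_nonpos_pos min_absorb2 max_absorb1)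
  moreover have "(uniform_cdf a b \<longlongrightarrow> 1) at_top"
    by (rule tendsto_eventually)
      (use eventually_ge_at_top[of b] in eventually_elim, use assms in \<open>simp add: uniform_cdf_def\<close>)
  ultimately show ?thesis
    by (simp add: mixed_strategy_def)
qed

text \<open>Linearity of expectation: the count is a sum of participation indicators, and each
  coordinate of the product measure has marginal \<open>action_measure (p, F)\<close>.\<close>

lemma expectation_submitted_txs:
  assumes s: "mixed_strategy (p, F)"
  shows "(\<integral>a. real (submitted_txs N a) \<partial>play N (\<lambda>_. (p, F))) = (1 - p) * real N"
proof -
  let ?A = "action_measure (p, F)"
  interpret product_prob_space "\<lambda>_. ?A" "{..<N}"
    by (simp add: product_prob_space_def product_prob_space_axioms_def product_sigma_finite_def
        prob_space_action_measure prob_space_imp_sigma_finite s)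
  have [measurable]: "Measurable.pred ?A participates"
    by (subst measurable_cong_sets[OF sets_action_measure refl]) measurable
  have "{a. participates a} \<in> sets ?A"
    using \<open>Measurable.pred ?A participates\<close> by (simp add: pred_def)
  have "emeasure ?A {a. participates a} = ennreal (1 - p)"
  proof -
    have "emeasure ?A {a. participates a} = (\<integral>\<^sup>+ a. indicator {a. participates a} a \<partial>?A)"
      using \<open>{a. participates a} \<in> sets ?A\<close> by simp
    also have "\<dots> = ennreal (1 - p) * (\<integral>\<^sup>+ b. 1 \<partial>interval_measure F) +
       ennreal p * (\<integral>\<^sup>+ b. 0 \<partial>interval_measure F)"
      using \<open>{a. participates a} \<in> sets ?A\<close>
      by (subst nn_integral_action_measure[OF s]) (auto simp: sets_action_measure)
    finally show ?thesis
      using prob_space.emeasure_space_1[OF prob_space_bid[OF s]] by simp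
  qed
  then have prob: "measure ?A {a. participates a} = 1 - p"
    using mixed_strategyD(2)[OF s] by (simp add: measure_def)
  have ind: "integrable ?A (\<lambda>a. of_bool (participates a) :: real)"
    "(\<integral>a. of_bool (participates a) \<partial>?A) = 1 - p"
  proof -
    have eq: "(\<lambda>a. of_bool (participates a) :: real) = indicator {a. participates a}"
      by (auto simp: indicator_def)
    show "integrable ?A (\<lambda>a. of_bool (participates a) :: real)"
      "(\<integral>a. of_bool (participates a) \<partial>?A) = 1 - p"
      unfolding eq using prob \<open>{a. participates a} \<in> sets ?A\<close>
      by (auto intro!: integrable_real_indicator simp: M.emeasure_eq_measure)
  qed
  have comp: "integrable (PiM {..<N} (\<lambda>_. ?A)) (\<lambda>a. of_bool (participates (a i)) :: real)"
    "(\<integral>a. of_bool (participates (a i)) \<partial>PiM {..<N} (\<lambda>_. ?A)) = 1 - p" if i: "i < N" for i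
  proof -
    have d: "distr (PiM {..<N} (\<lambda>_. ?A)) ?A (\<lambda>a. a i) = ?A"
      using i by (intro PiM_component) simp
    have m: "(\<lambda>a. a i) \<in> PiM {..<N} (\<lambda>_. ?A) \<rightarrow>\<^sub>M ?A"
      using i by simp
    have f: "(\<lambda>a. of_bool (participates a) :: real) \<in> borel_measurable ?A"
      using ind(1) by simp
    show "integrable (PiM {..<N} (\<lambda>_. ?A)) (\<lambda>a. of_bool (participates (a i)) :: real)"
      using ind(1) integrable_distr_eq[OF m f] unfolding d by simp
    show "(\<integral>a. of_bool (participates (a i)) \<partial>PiM {..<N} (\<lambda>_. ?A)) = 1 - p"
      using ind(2) integral_distr[OF m f] unfolding d by simp
  qed
  have "real (submitted_txs N a) = (\<Sum>i<N. of_bool (participates (a i)))" for a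
  proof -
    have "{i. i < N \<and> participates (a i)} = {..<N} \<inter> {i. participates (a i)}"
      by auto
    then show ?thesis
      by (simp add: submitted_txs_def sum_of_bool_eq)
  qed
  note count = this
  have "(\<integral>a. real (submitted_txs N a) \<partial>play N (\<lambda>_. (p, F))) =
      (\<Sum>i<N. \<integral>a. of_bool (participates (a i)) \<partial>PiM {..<N} (\<lambda>_. ?A))"
    unfolding play_def count by (rule Bochner_Integration.integral_sum) (use comp(1) in simp)
  also have "\<dots> = (1 - p) * real N"
    using comp(2) by simp
  finally show ?thesis .
qed

subsection \<open>Expected payoffs against identical opponents\<close>

locale auction =
  fixes N :: nat and V g r1 r2 :: real
  assumes N: "N \<ge> 2" and g: "0 < g" and gV: "g < V"
    and r1: "0 \<le> r1" and r2: "0 \<le> r2" and r12: "r1 \<noteq> 0 \<or> r2 \<noteq> 0"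
begin

section \<open>Win probability, cost and payoff of a fixed bid\<close>

definition win_prob :: "strategy \<Rightarrow> real \<Rightarrow> real" where
  "win_prob s b = (fst s + (1 - fst s) * snd s b) ^ (N - 1)"

text \<open>The cost is kept apart from the value because its expectation may be infinite, while the
  expected value received is bounded by \<open>V\<close>.\<close>

definition bid_cost :: "strategy \<Rightarrow> real \<Rightarrow> real" where
  "bid_cost s b = win_prob s b * (g + b) + (1 - win_prob s b) * (r1 * g + r2 * b)"

definition bid_payoff :: "strategy \<Rightarrow> real \<Rightarrow> real" where
  "bid_payoff s b = V * win_prob s b - bid_cost s b"

lemma mix_bounds:
  assumes "mixed_strategy s"
  shows "0 \<le> fst s + (1 - fst s) * snd s b" "fst s + (1 - fst s) * snd s b \<le> 1"
proof -
  have s: "mixed_strategy (fst s, snd s)"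
    using assms by simp
  note F = mixed_strategyD(1,2)[OF s] mixed_strategy_cdf_nonneg[OF s, of b]
    mixed_strategy_cdf_le_1[OF s, of b]
  then show "0 \<le> fst s + (1 - fst s) * snd s b"
    by simp
  have "(1 - fst s) * snd s b \<le> (1 - fst s) * 1"
    using F by (intro mult_left_mono) auto
  then show "fst s + (1 - fst s) * snd s b \<le> 1"
    by simp
qed

lemma win_prob_bounds:
  assumes "mixed_strategy s"
  shows "0 \<le> win_prob s b" "win_prob s b \<le> 1"
  using mix_bounds[OF assms, of b] by (auto simp: win_prob_def power_le_one)

lemma bid_cost_nonneg:
  assumes "mixed_strategy s" "0 \<le> b"
  shows "0 \<le> bid_cost s b"
  using win_prob_bounds[OF assms(1), of b] assms(2) g r1 r2 by (simp add: bid_cost_def)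

lemma continuous_on_win_prob:
  assumes "mixed_strategy s"
  shows "continuous_on A (win_prob s)"
proof -
  have "continuous_on A (snd s)"
    using assms by (cases s) (auto dest: mixed_strategyD(4) intro: continuous_on_subset)
  then show ?thesis
    unfolding win_prob_def by (intro continuous_intros)
qed

lemma continuous_on_bid_cost:
  "mixed_strategy s \<Longrightarrow> continuous_on A (bid_cost s)"
  unfolding bid_cost_def by (intro continuous_intros continuous_on_win_prob)

lemma continuous_on_bid_payoff:
  "mixed_strategy s \<Longrightarrow> continuous_on A (bid_payoff s)"
  unfolding bid_payoff_def by (intro continuous_intros continuous_on_win_prob continuous_on_bid_cost)

lemma measurable_win_prob [measurable]:
  "mixed_strategy s \<Longrightarrow> win_prob s \<in> borel_measurable borel"
  by (intro borel_measurable_continuous_onI continuous_on_win_prob)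

lemma measurable_bid_cost [measurable]:
  "mixed_strategy s \<Longrightarrow> bid_cost s \<in> borel_measurable borel"
  by (intro borel_measurable_continuous_onI continuous_on_bid_cost)

lemma measurable_bid_payoff [measurable]:
  "mixed_strategy s \<Longrightarrow> bid_payoff s \<in> borel_measurable borel"
  by (intro borel_measurable_continuous_onI continuous_on_bid_payoff)

section \<open>Integrating out the opponents\<close>

lemma measurable_action [measurable]:
  assumes "i < N"
  shows "(\<lambda>a. a i) \<in> (\<Pi>\<^sub>M j\<in>{..<N}. action_measure (\<sigma> j)) \<rightarrow>\<^sub>M count_space UNIV \<Otimes>\<^sub>M borel"
  using measurable_component_singleton[of i "{..<N}" "\<lambda>j. action_measure (\<sigma> j)"] assms
    measurable_cong_sets[OF refl sets_action_measure] by fastforce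

lemma measurable_wins [measurable]:
  assumes [measurable]: "i < N"
  shows "Measurable.pred (\<Pi>\<^sub>M j\<in>{..<N}. action_measure (\<sigma> j)) (\<lambda>a. wins N a i)"
proof -
  \<comment> \<open>Once \<open>bid (a j) < bid (a i)\<close> fails, equality of the bids amounts to
    the failure of \<open>bid (a i) < bid (a j)\<close>. Only strict comparisons under a finite
    quantifier remain.\<close>
  have wins_iff: "wins N a i \<longleftrightarrow> participates (a i) \<and>
     (\<forall>j\<in>{..<N}. \<not> (j \<noteq> i \<and> participates (a j)) \<or>
        bid (a j) < bid (a i) \<or> \<not> bid (a i) < bid (a j) \<and> i < j)" for a
    by (auto simp: wins_def)
  show ?thesis
    unfolding wins_iff
  proof (intro pred_intros_logic pred_intros_finite)
    fix j assume "j \<in> {..<N}"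
    then have [measurable]: "j < N" by simp
    show "Measurable.pred (\<Pi>\<^sub>M j\<in>{..<N}. action_measure (\<sigma> j)) (\<lambda>a. bid (a j) < bid (a i))"
      by measurable
    show "Measurable.pred (\<Pi>\<^sub>M j\<in>{..<N}. action_measure (\<sigma> j)) (\<lambda>a. bid (a i) < bid (a j))"
      by measurable
    show "Measurable.pred (\<Pi>\<^sub>M j\<in>{..<N}. action_measure (\<sigma> j)) (\<lambda>a. participates (a j))"
      by measurable
  next
    show "Measurable.pred (\<Pi>\<^sub>M j\<in>{..<N}. action_measure (\<sigma> j)) (\<lambda>a. participates (a i))"
      by measurable
  qed simp_all
qed

text \<open>A participant bidding \<open>b\<close> wins iff every opponent abstains or bids in a half-line ending
  at \<open>b\<close>; whether the half-line is closed depends on the tie-breaking rule, but its probability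
  does not.\<close>

lemma nn_integral_opponents:
  assumes t: "mixed_strategy t" and i: "i < N"
    and \<sigma>: "\<And>j. j \<noteq> i \<Longrightarrow> \<sigma> j = t" "mixed_strategy (\<sigma> i)"
  shows "(\<integral>\<^sup>+ a. (if wins N (a(i := (True, b))) i then c else d)
      \<partial>(\<Pi>\<^sub>M j\<in>{..<N} - {i}. action_measure (\<sigma> j))) =
    c * ennreal (win_prob t b) + d * ennreal (1 - win_prob t b)"
proof -
  let ?J = "{..<N} - {i}"
  let ?M = "\<Pi>\<^sub>M j\<in>?J. action_measure (\<sigma> j)"
  have ms: "mixed_strategy (\<sigma> j)" for j
    using \<sigma> t by (cases "j = i") auto
  then interpret product_prob_space "\<lambda>j. action_measure (\<sigma> j)" ?J
    by (simp add: product_prob_space_def product_prob_space_axioms_def product_sigma_finite_def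
        prob_space_action_measure prob_space_imp_sigma_finite)
  define A where "A j = {a. participates a \<longrightarrow> bid a \<in> (if i < j then {..b} else {..<b})}" for j :: nat
  have A: "A j \<in> sets (action_measure t)"
    "emeasure (action_measure t) (A j) = ennreal (fst t + (1 - fst t) * snd t b)" for j
    using emeasure_action_measure_losing[of "fst t" "snd t" "if i < j then {..b} else {..<b}" b] t
    by (auto simp: A_def)
  have emA: "emeasure ?M (Pi\<^sub>E ?J A) = ennreal (win_prob t b)"
  proof -
    have "emeasure ?M (Pi\<^sub>E ?J A) = (\<Prod>j\<in>?J. emeasure (action_measure (\<sigma> j)) (A j))"
      using A(1) \<sigma> by (intro emeasure_PiM) auto
    also have "\<dots> = (\<Prod>j\<in>?J. ennreal (fst t + (1 - fst t) * snd t b))"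
      using A(2) \<sigma> by (intro prod.cong) auto
    finally show ?thesis
      using i mix_bounds[OF t, of b] by (simp add: win_prob_def ennreal_power)
  qed
  have setsA [measurable]: "Pi\<^sub>E ?J A \<in> sets ?M"
    using A(1) \<sigma> by (intro sets_PiM_I_finite) auto
  have emC: "emeasure ?M (space ?M - Pi\<^sub>E ?J A) = ennreal (1 - win_prob t b)"
    using prob_compl[OF setsA] emA by (simp add: P.emeasure_eq_measure win_prob_bounds[OF t])
  have if_eq_indicators: "(if w then c else d) = c * indicator S a + d * indicator (T - S) a"
    if "w \<longleftrightarrow> a \<in> S" "a \<in> T" for w a and S T :: "(nat \<Rightarrow> action) set"
    using that by (auto simp: indicator_def)
  have "(if wins N (a(i := (True, b))) i then c else d) =
      c * indicator (Pi\<^sub>E ?J A) a + d * indicator (space ?M - Pi\<^sub>E ?J A) a"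
    if "a \<in> space ?M" for a
  proof -
    have in_A: "a j \<in> A j \<longleftrightarrow>
        (participates (a j) \<longrightarrow> bid (a j) < b \<or> bid (a j) = b \<and> i < j)" for j
      by (auto simp: A_def)
    have "wins N (a(i := (True, b))) i \<longleftrightarrow> (\<forall>j\<in>?J. a j \<in> A j)"
      unfolding in_A by (auto simp: wins_def)
    also have "\<dots> \<longleftrightarrow> a \<in> Pi\<^sub>E ?J A"
      using that by (simp add: space_PiM PiE_iff)
    finally show ?thesis
      by (rule if_eq_indicators) (rule that)
  qed
  then have "(\<integral>\<^sup>+ a. (if wins N (a(i := (True, b))) i then c else d) \<partial>?M) =
     (\<integral>\<^sup>+ a. c * indicator (Pi\<^sub>E ?J A) a + d * indicator (space ?M - Pi\<^sub>E ?J A) a \<partial>?M)"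
    by (rule nn_integral_cong)
  also have "\<dots> = c * ennreal (win_prob t b) + d * ennreal (1 - win_prob t b)"
    using setsA by (simp add: nn_integral_add nn_integral_cmult_indicator emA emC)
  finally show ?thesis .
qed

text \<open>Fubini with agent \<open>i\<close> integrated last: for a fixed bid the opponents enter
  only through the win probability, and abstention contributes \<open>0\<close>. Both
  \<open>received\<close> and \<open>payment\<close> are instances, with \<open>c\<close> the amount
  on winning and \<open>d\<close> the amount on losing.\<close>

lemma nn_integral_play:
  assumes t: "mixed_strategy t" and s: "mixed_strategy (q, H)" and i: "i < N"
    and f: "\<And>a. f a = (if wins N a i then c (bid (a i))
      else if participates (a i) then d (bid (a i)) else 0)"
    and [measurable]: "c \<in> borel_measurable borel" "d \<in> borel_measurable borel"
  shows "(\<integral>\<^sup>+ a. f a \<partial>play N ((\<lambda>_. t)(i := (q, H)))) =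
    ennreal (1 - q) * (\<integral>\<^sup>+ b. c b * ennreal (win_prob t b) + d b * ennreal (1 - win_prob t b)
      \<partial>interval_measure H)"
proof -
  define \<sigma> where "\<sigma> = (\<lambda>_. t)(i := (q, H))"
  let ?J = "{..<N} - {i}"
  have ms: "mixed_strategy (\<sigma> j)" for j
    using s t by (auto simp: \<sigma>_def)
  then interpret product_prob_space "\<lambda>j. action_measure (\<sigma> j)" ?J
    by (simp add: product_prob_space_def product_prob_space_axioms_def product_sigma_finite_def
        prob_space_action_measure prob_space_imp_sigma_finite)
  have ins: "insert i ?J = {..<N}"
    using i by auto
  have f_meas: "f \<in> borel_measurable (\<Pi>\<^sub>M j\<in>{..<N}. action_measure (\<sigma> j))"
    unfolding f[abs_def] using i by measurable
  have *: "(\<integral>\<^sup>+ a. f (a(i := (x, b))) \<partial>(\<Pi>\<^sub>M j\<in>?J. action_measure (\<sigma> j))) =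
     (if x then c b * ennreal (win_prob t b) + d b * ennreal (1 - win_prob t b) else 0)" for x b
  proof (cases x)
    case True
    then have "(\<integral>\<^sup>+ a. f (a(i := (x, b))) \<partial>(\<Pi>\<^sub>M j\<in>?J. action_measure (\<sigma> j))) =
      (\<integral>\<^sup>+ a. (if wins N (a(i := (True, b))) i then c b else d b)
        \<partial>(\<Pi>\<^sub>M j\<in>?J. action_measure (\<sigma> j)))"
      by (intro nn_integral_cong) (simp add: f)
    also have "\<dots> = c b * ennreal (win_prob t b) + d b * ennreal (1 - win_prob t b)"
      by (intro nn_integral_opponents) (use t s i in \<open>auto simp: \<sigma>_def\<close>)
    finally show ?thesis
      using True by simp
  qed (simp add: f wins_def)
  have "(\<integral>\<^sup>+ a. f a \<partial>play N \<sigma>) =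
    (\<integral>\<^sup>+ x. \<integral>\<^sup>+ a. f (a(i := x)) \<partial>(\<Pi>\<^sub>M j\<in>?J. action_measure (\<sigma> j)) \<partial>action_measure (\<sigma> i))"
    using product_nn_integral_insert_rev[of ?J i f] f_meas unfolding ins play_def by simp
  also have "\<dots> = (\<integral>\<^sup>+ x. (if participates x then c (bid x) * ennreal (win_prob t (bid x)) +
      d (bid x) * ennreal (1 - win_prob t (bid x)) else 0) \<partial>action_measure (\<sigma> i))"
    by (intro nn_integral_cong) (metis * prod.collapse)
  also have "\<dots> = ennreal (1 - q) *
      (\<integral>\<^sup>+ b. c b * ennreal (win_prob t b) + d b * ennreal (1 - win_prob t b) \<partial>interval_measure H)"
    using t by (simp add: \<sigma>_def nn_integral_action_measure[OF s])
  finally show ?thesis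
    by (simp add: \<sigma>_def)
qed

lemma expected_payoff_deviation:
  assumes t: "mixed_strategy t" and s: "mixed_strategy (q, H)" and i: "i < N"
  shows "expected_payoff N V g r1 r2 ((\<lambda>_. t)(i := (q, H))) i =
    enn2ereal (ennreal (1 - q) * (\<integral>\<^sup>+ b. ennreal (V * win_prob t b) \<partial>interval_measure H)) -
    enn2ereal (ennreal (1 - q) * (\<integral>\<^sup>+ b. ennreal (bid_cost t b) \<partial>interval_measure H))"
proof -
  have "(\<integral>\<^sup>+ a. ennreal (received N V a i) \<partial>play N ((\<lambda>_. t)(i := (q, H)))) =
    ennreal (1 - q) * (\<integral>\<^sup>+ b. ennreal V * ennreal (win_prob t b) + 0 * ennreal (1 - win_prob t b)
      \<partial>interval_measure H)"
    by (rule nn_integral_play[OF t s i]) (auto simp: received_def)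
  moreover have "(\<integral>\<^sup>+ a. ennreal (payment N g r1 r2 a i) \<partial>play N ((\<lambda>_. t)(i := (q, H)))) =
    ennreal (1 - q) * (\<integral>\<^sup>+ b. ennreal (g + b) * ennreal (win_prob t b) +
      ennreal (r1 * g + r2 * b) * ennreal (1 - win_prob t b) \<partial>interval_measure H)"
    by (rule nn_integral_play[OF t s i]) (auto simp: payment_def)
  moreover have "(\<integral>\<^sup>+ b. ennreal (g + b) * ennreal (win_prob t b) +
      ennreal (r1 * g + r2 * b) * ennreal (1 - win_prob t b) \<partial>interval_measure H) =
    (\<integral>\<^sup>+ b. ennreal (bid_cost t b) \<partial>interval_measure H)"
  \<comment> \<open>\<open>ennreal\<close> truncates negative numbers to \<open>0\<close>, so the
    two terms combine only for nonnegative bids, that is, almost everywhere.\<close>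
  proof (rule nn_integral_cong_AE)
    show "AE b in interval_measure H. ennreal (g + b) * ennreal (win_prob t b) +
      ennreal (r1 * g + r2 * b) * ennreal (1 - win_prob t b) = ennreal (bid_cost t b)"
      using AE_bid_nonneg[OF s]
    proof eventually_elim
      case (elim b)
      then show ?case
        using win_prob_bounds[OF t, of b] g r1 r2
        by (simp add: bid_cost_def ennreal_mult[symmetric] ennreal_plus[symmetric] mult.commute
            del: ennreal_plus)
    qed
  qed
  ultimately show ?thesis
    using g gV win_prob_bounds[OF t] by (simp add: expected_payoff_def ennreal_mult)
qed

lemma bid_payoff_eq:
  "bid_payoff s b = win_prob s b * (V - g - b) - (1 - win_prob s b) * (r1 * g + r2 * b)"
  by (simp add: bid_payoff_def bid_cost_def algebra_simps)

lemma integrable_win_prob: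
  assumes "mixed_strategy t" "mixed_strategy (q, H)"
  shows "integrable (interval_measure H) (\<lambda>b. V * win_prob t b)"
proof -
  interpret prob_space "interval_measure H"
    by (rule prob_space_bid[OF assms(2)])
  show ?thesis
    using assms(1) win_prob_bounds[OF assms(1)]
    by (intro integrable_mult_right integrable_const_bound[where B = 1]) auto
qed

text \<open>Once the expected cost is finite, the extended-real difference is an ordinary integral
  of \<open>bid_payoff\<close>.\<close>

lemma expected_payoff_integrable:
  assumes t: "mixed_strategy t" and s: "mixed_strategy (q, H)" and i: "i < N"
    and c: "integrable (interval_measure H) (bid_cost t)"
  shows "integrable (interval_measure H) (bid_payoff t)"
    and "expected_payoff N V g r1 r2 ((\<lambda>_. t)(i := (q, H))) i =
      ereal ((1 - q) * (\<integral>b. bid_payoff t b \<partial>interval_measure H))"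
proof -
  note w = integrable_win_prob[OF t s]
  show "integrable (interval_measure H) (bid_payoff t)"
    unfolding bid_payoff_def[abs_def] by (intro Bochner_Integration.integrable_diff w c)
  have nonneg: "AE b in interval_measure H. 0 \<le> bid_cost t b"
    using AE_bid_nonneg[OF s] by eventually_elim (simp add: bid_cost_nonneg[OF t])
  have wn: "AE b in interval_measure H. 0 \<le> V * win_prob t b"
    using win_prob_bounds[OF t] g gV by simp
  have "(\<integral>b. bid_payoff t b \<partial>interval_measure H) =
    (\<integral>b. V * win_prob t b \<partial>interval_measure H) - (\<integral>b. bid_cost t b \<partial>interval_measure H)"
    unfolding bid_payoff_def by (intro Bochner_Integration.integral_diff w c)
  then show "expected_payoff N V g r1 r2 ((\<lambda>_. t)(i := (q, H))) i =
      ereal ((1 - q) * (\<integral>b. bid_payoff t b \<partial>interval_measure H))"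
    unfolding expected_payoff_deviation[OF t s i] nn_integral_eq_integral[OF w wn]
      nn_integral_eq_integral[OF c nonneg]
    using mixed_strategyD(1,2)[OF s] integral_nonneg_AE[OF wn] integral_nonneg_AE[OF nonneg]
    by (simp add: ennreal_mult[symmetric] enn2ereal_ennreal right_diff_distrib
        del: integral_mult_right_zero)
qed

text \<open>The expected value is finite, so with positive participation probability an infinite
  expected cost would push the payoff to minus infinity.\<close>

lemma integrable_bid_cost:
  assumes t: "mixed_strategy t" and s: "mixed_strategy (q, H)" and i: "i < N" and q: "q < 1"
    and P: "0 \<le> expected_payoff N V g r1 r2 ((\<lambda>_. t)(i := (q, H))) i"
  shows "integrable (interval_measure H) (bid_cost t)"
proof (rule integrableI_nonneg)
  show "AE b in interval_measure H. 0 \<le> bid_cost t b"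
    using AE_bid_nonneg[OF s] by eventually_elim (simp add: bid_cost_nonneg[OF t])
  show "(\<integral>\<^sup>+ b. ennreal (bid_cost t b) \<partial>interval_measure H) < \<infinity>"
  proof (rule ccontr)
    assume "\<not> ?thesis"
    then have inf: "ennreal (1 - q) * (\<integral>\<^sup>+ b. ennreal (bid_cost t b) \<partial>interval_measure H) = \<infinity>"
      using q by (simp add: top.not_eq_extremum[symmetric] ennreal_mult_eq_top_iff)
    have "(\<integral>\<^sup>+ b. ennreal (V * win_prob t b) \<partial>interval_measure H) < \<infinity>"
      using integrable_win_prob[OF t s] win_prob_bounds[OF t] g gV
      by (subst nn_integral_eq_integral) auto
    then have "ennreal (1 - q) * (\<integral>\<^sup>+ b. ennreal (V * win_prob t b) \<partial>interval_measure H) < \<infinity>"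
      by (simp add: ennreal_mult_less_top)
    then show False
      using P unfolding expected_payoff_deviation[OF t s i] inf
      by (cases "ennreal (1 - q) * (\<integral>\<^sup>+ b. ennreal (V * win_prob t b) \<partial>interval_measure H)")
        (auto simp: enn2ereal_ennreal)
  qed
qed (use t in simp)

text \<open>The outside option. The factor \<open>1 - q\<close> is \<open>0\<close> and annihilates
  even an infinite expected cost in \<open>ennreal\<close>.\<close>

lemma expected_payoff_abstain:
  assumes "mixed_strategy t" "mixed_strategy (1, H)" "i < N"
  shows "expected_payoff N V g r1 r2 ((\<lambda>_. t)(i := (1, H))) i = 0"
  using expected_payoff_deviation[OF assms] by (simp add: zero_ereal_def[symmetric])

text \<open>The bids stay in a compact interval, where the continuous cost is bounded; the payoff is
  then an average of values that are at least \<open>K\<close>.\<close>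

lemma expected_payoff_uniform_ge:
  assumes t: "mixed_strategy t" and i: "i < N" and ab: "0 \<le> a" "a < b"
    and K: "\<And>x. x \<in> {a..b} \<Longrightarrow> K \<le> bid_payoff t x"
  shows "ereal K \<le> expected_payoff N V g r1 r2 ((\<lambda>_. t)(i := (0, uniform_cdf a b))) i"
proof -
  note s = mixed_strategy_uniform[OF ab]
  interpret prob_space "interval_measure (uniform_cdf a b)"
    by (rule prob_space_bid[OF s])
  have supp: "AE x in interval_measure (uniform_cdf a b). x \<in> {a..b}"
    using AE_bid_ge[OF s, of a] AE_bid_le[OF s, of b] ab by (auto simp: uniform_cdf_def)
  have "bounded (bid_cost t ` {a..b})"
    by (intro compact_imp_bounded compact_continuous_image continuous_on_bid_cost t compact_Icc)
  then obtain B where B: "\<And>x. x \<in> {a..b} \<Longrightarrow> norm (bid_cost t x) \<le> B"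
    unfolding bounded_iff by blast
  have "integrable (interval_measure (uniform_cdf a b)) (bid_cost t)"
  proof (rule integrable_const_bound[where B = B])
    show "AE x in interval_measure (uniform_cdf a b). norm (bid_cost t x) \<le> B"
      using supp by eventually_elim (rule B)
  qed (use t in simp)
  note * = expected_payoff_integrable[OF t s i this]
  have "K \<le> (\<integral>x. bid_payoff t x \<partial>interval_measure (uniform_cdf a b))"
    using supp by (intro integral_ge_const *(1)) (use K in \<open>auto elim!: eventually_mono simp del: atLeastAtMost_iff\<close>)
  then show ?thesis
    by (simp add: *(2))
qed

section \<open>Optimality of individual bids in a symmetric equilibrium\<close>

text \<open>Near \<open>b\<close>, continuity keeps the payoff above any \<open>K\<close> below its
  value at \<open>b\<close>, so a narrow uniform deviation earns at least \<open>K\<close>.\<close>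

lemma bid_payoff_le_equilibrium_payoff:
  assumes E: "nash_equilibrium N V g r1 r2 (\<lambda>_. t)" and i: "i < N" and b: "0 \<le> b"
  shows "ereal (bid_payoff t b) \<le> expected_payoff N V g r1 r2 (\<lambda>_. t) i"
proof (rule dense_le)
  fix K' assume "K' < ereal (bid_payoff t b)"
  \<comment> \<open>\<open>K'\<close> may be minus infinity, whereas the bound for uniform
    deviations takes a real number.\<close>
  then obtain K where K: "K' \<le> ereal K" "K < bid_payoff t b"
    by (metis ereal_dense2 less_ereal.simps(1) less_imp_le)
  have t: "mixed_strategy t"
    using E i by (auto simp: nash_equilibrium_def)
  have "isCont (bid_payoff t) b"
    using continuous_on_bid_payoff[OF t, of UNIV] by (simp add: continuous_on_eq_continuous_at)
  then have "\<forall>\<^sub>F x in nhds b. K < bid_payoff t x"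
    using K(2) by (intro order_tendstoD(1)[of _ "bid_payoff t b"])
      (simp_all add: isCont_def tendsto_at_iff_tendsto_nhds)
  then obtain e where e: "e > 0" "\<And>x. dist x b < e \<Longrightarrow> K < bid_payoff t x"
    by (auto simp: eventually_nhds_metric)
  \<comment> \<open>The interval extends to the right only, which keeps bids nonnegative when
    \<open>b = 0\<close>.\<close>
  have "ereal K \<le> expected_payoff N V g r1 r2 ((\<lambda>_. t)(i := (0, uniform_cdf b (b + e / 2)))) i"
    using b e by (intro expected_payoff_uniform_ge t i less_imp_le[OF e(2)]) (auto simp: dist_real_def)
  also have "\<dots> \<le> expected_payoff N V g r1 r2 (\<lambda>_. t) i"
    using E i mixed_strategy_uniform[of b "b + e / 2"] b e(1) by (simp add: nash_equilibrium_def)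
  finally show "K' \<le> expected_payoff N V g r1 r2 (\<lambda>_. t) i"
    using K(1) by (rule order_trans[rotated])
qed

text \<open>While the bid distribution is flat the win probability is constant, so raising the bid
  never pays. Hence a gap in the support would have to extend to infinity.\<close>

lemma cdf_eq_1_if_suboptimal:
  assumes s: "mixed_strategy (p, F)"
    and AE: "AE x in interval_measure F. bid_payoff (p, F) x = M"
    and b: "0 \<le> b" "bid_payoff (p, F) b < M"
  shows "F b = 1"
proof -
  note F = mixed_strategyD[OF s]
  \<comment> \<open>Suboptimal bids form a null set, and the endpoint \<open>d\<close>, which may be
    optimal, is null because \<open>F\<close> has no atoms.\<close>
  have flat: "F d = F b" if "b \<le> d" "\<And>x. b \<le> x \<Longrightarrow> x < d \<Longrightarrow> bid_payoff (p, F) x < M" for d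
  proof -
    have "AE x in interval_measure F. x \<notin> {b..d}"
      using AE AE_bid_neq[OF s, of d]
    proof eventually_elim
      case (elim x)
      then show ?case
        using that(2)[of x] by force
    qed
    then have "emeasure (interval_measure F) {b..d} = 0"
      by (subst (asm) AE_iff_measurable[of "{b..d}"]) auto
    then have "F d \<le> F b"
      using emeasure_bid_atLeastAtMost[OF s that(1)] by (simp add: ennreal_eq_0_iff)
    then show ?thesis
      using monoD[OF F(3) that(1)] by simp
  qed
  \<comment> \<open>If nonempty, this closed set has a least element, the upper end of the gap
    starting at \<open>b\<close>. It has the win probability of \<open>b\<close> but a higher bid,
    hence cannot be worth more.\<close>
  define S where "S = {x. b \<le> x \<and> M \<le> bid_payoff (p, F) x}"
  have "S = {}"
  proof (rule ccontr)
    assume "S \<noteq> {}"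
    moreover have "closed S"
      unfolding S_def
      by (intro closed_Collect_conj closed_Collect_le continuous_on_bid_payoff s continuous_intros)
    moreover have bdd: "bdd_below S"
      by (rule bdd_belowI[of _ b]) (simp add: S_def)
    ultimately have d: "Inf S \<in> S"
      by (intro closed_contains_Inf)
    have "F (Inf S) = F b"
    proof (rule flat)
      show "b \<le> Inf S"
        using d by (simp add: S_def)
      show "bid_payoff (p, F) x < M" if "b \<le> x" "x < Inf S" for x
        using cInf_lower[OF _ bdd, of x] that by (force simp: S_def)
    qed
    then have W: "win_prob (p, F) (Inf S) = win_prob (p, F) b"
      by (simp add: win_prob_def)
    have "bid_payoff (p, F) (Inf S) \<le> bid_payoff (p, F) b"
      unfolding bid_payoff_eq W using d win_prob_bounds[OF s, of b] r2
      by (intro diff_mono mult_left_mono add_left_mono) (auto simp: S_def)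
    then show False
      using d b by (simp add: S_def)
  qed
  then have "bid_payoff (p, F) x < M" if "b \<le> x" for x
    using that unfolding S_def by fastforce
  then have "F d = F b" if "b \<le> d" for d
    by (rule flat[OF that])
  then have "\<forall>\<^sub>F d in at_top. F d = F b"
    by (rule eventually_mono[OF eventually_ge_at_top])
  then have "(F \<longlongrightarrow> F b) at_top"
    by (rule tendsto_eventually)
  then show ?thesis
    using F(6) tendsto_unique trivial_limit_at_top_linorder by blast
qed

subsection \<open>The symmetric equilibrium\<close>

text \<open>The win probability at which the bid \<open>b\<close> breaks even.\<close>

definition bid_ratio :: "real \<Rightarrow> real" where
  "bid_ratio b = (r1 * g + r2 * b) / (V - g - b + r1 * g + r2 * b)"

text \<open>Clipping to \<open>{0..V - g}\<close> extends the equilibrium formula to the whole line.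
  \<open>root\<close> inverts the power in \<open>win_prob\<close> on all nonnegative numbers,
  including the value \<open>bid_ratio 0 = 0\<close> that occurs for \<open>r1 = 0\<close>.\<close>

definition bid_cdf :: "real \<Rightarrow> real" where
  "bid_cdf b = (root (N - 1) (bid_ratio (max 0 (min b (V - g)))) - p_star N V g r1) /
     (1 - p_star N V g r1)"

text \<open>Below \<open>V - g\<close> the term \<open>V - g - b\<close> is positive; at
  \<open>V - g\<close> only the penalty is left, and it is positive because one of the rates is
  nonzero.\<close>

lemma bid_ratio_denom_pos:
  assumes "0 \<le> b" "b \<le> V - g"
  shows "0 < V - g - b + r1 * g + r2 * b"
proof -
  have *: "0 \<le> r1 * g" "0 \<le> r2 * b"
    using assms r1 r2 g by auto
  show ?thesis
  proof (cases "b = V - g")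
    case True
    then have "0 < r1 * g \<or> 0 < r2 * b"
      using r12 r1 r2 g gV by auto
    then show ?thesis
      using * True by auto
  next
    case False
    then show ?thesis
      using * assms by auto
  qed
qed

lemma bid_ratio_nonneg:
  "0 \<le> b \<Longrightarrow> b \<le> V - g \<Longrightarrow> 0 \<le> bid_ratio b"
  using bid_ratio_denom_pos[of b] r1 r2 g by (simp add: bid_ratio_def)

lemma bid_ratio_mono:
  assumes "0 \<le> a" "a \<le> b" "b \<le> V - g"
  shows "bid_ratio a \<le> bid_ratio b"
proof -
  have "(r1 * g + r2 * a) * (V - g - b) \<le> (r1 * g + r2 * b) * (V - g - a)"
    using assms r1 r2 g by (intro mult_mono add_mono mult_left_mono) auto
  then show ?thesis
    using bid_ratio_denom_pos[of a] bid_ratio_denom_pos[of b] assms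
      divide_add_self_le_iff[of "V - g - a" "r1 * g + r2 * a" "V - g - b" "r1 * g + r2 * b"]
    by (simp add: bid_ratio_def add.assoc)
qed

lemma bid_ratio_top: "bid_ratio (V - g) = 1"
  using bid_ratio_denom_pos[of "V - g"] gV by (simp add: bid_ratio_def)

text \<open>The payoff is affine in the win probability, and its slope is the positive denominator
  of \<open>bid_ratio b\<close>.\<close>

lemma bid_payoff_eq_0_iff:
  assumes "0 \<le> b" "b \<le> V - g"
  shows "bid_payoff s b = 0 \<longleftrightarrow> win_prob s b = bid_ratio b"
  using bid_ratio_denom_pos[OF assms]
  by (auto simp: bid_ratio_def bid_payoff_eq field_simps)

lemma p_star_eq_root: "p_star N V g r1 = root (N - 1) (bid_ratio 0)"
\<comment> \<open>The conversion between \<open>root\<close> and \<open>powr\<close> is applied to a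
  positive base; for \<open>r1 = 0\<close> both sides are \<open>0\<close>.\<close>
proof (cases "r1 = 0")
  case True
  then show ?thesis
    unfolding p_star_def bid_ratio_def by simp
next
  case False
  then have "0 < r1 * g / (V - g + r1 * g)"
    using r1 g gV by (intro divide_pos_pos add_pos_pos mult_pos_pos) auto
  then show ?thesis
    using N by (simp add: p_star_def bid_ratio_def root_powr_inverse of_nat_diff)
qed

lemma p_star_bounds: "0 \<le> p_star N V g r1" "p_star N V g r1 < 1"
proof -
  have "bid_ratio 0 < 1"
    using bid_ratio_denom_pos[of 0] gV by (simp add: bid_ratio_def)
  then show "p_star N V g r1 < 1"
    using N real_root_less_mono[of "N - 1" "bid_ratio 0" 1] by (simp add: p_star_eq_root)
  show "0 \<le> p_star N V g r1"
    by (simp add: p_star_def)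
qed

text \<open>The root of \<open>bid_ratio\<close> climbs from \<open>p_star\<close> at
  \<open>0\<close> to \<open>1\<close> at \<open>V - g\<close>, so its affine rescaling runs from
  \<open>0\<close> to \<open>1\<close>.\<close>

lemma mixed_strategy_bid_cdf: "mixed_strategy (p_star N V g r1, bid_cdf)"
proof -
  note p = p_star_bounds
  have "mono bid_cdf"
  proof (rule monoI)
    fix x y :: real assume "x \<le> y"
    then have "bid_ratio (max 0 (min x (V - g))) \<le> bid_ratio (max 0 (min y (V - g)))"
      using gV by (intro bid_ratio_mono) auto
    then show "bid_cdf x \<le> bid_cdf y"
      unfolding bid_cdf_def using N p by (intro divide_right_mono diff_right_mono) auto
  qed
  moreover have "continuous_on UNIV bid_cdf"
  proof -
    have "V - g - max 0 (min b (V - g)) + r1 * g + r2 * max 0 (min b (V - g)) \<noteq> 0" for b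
      using bid_ratio_denom_pos[of "max 0 (min b (V - g))"] gV by simp
    then show ?thesis
      unfolding bid_cdf_def bid_ratio_def using p by (intro continuous_intros) auto
  qed
  moreover have "bid_cdf b = 0" if "b < 0" for b
    using that gV by (simp add: bid_cdf_def p_star_eq_root min_absorb1 max_absorb1)
  moreover have "(bid_cdf \<longlongrightarrow> 1) at_top"
  proof (rule tendsto_eventually)
    show "\<forall>\<^sub>F b in at_top. bid_cdf b = 1"
      using eventually_ge_at_top[of "V - g"]
      by eventually_elim (use N gV p bid_ratio_top in \<open>simp add: bid_cdf_def\<close>)
  qed
  ultimately show ?thesis
    using p by (simp add: mixed_strategy_def)
qed

lemma bid_cdf_eq_1: "V - g \<le> b \<Longrightarrow> bid_cdf b = 1"
  using N gV p_star_bounds bid_ratio_top by (simp add: bid_cdf_def)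

lemma bid_cdf_eqI:
  assumes "0 \<le> b" "b \<le> V - g" "0 \<le> c"
    and "c = p_star N V g r1 + (1 - p_star N V g r1) * x" "c ^ (N - 1) = bid_ratio b"
  shows "x = bid_cdf b"
proof -
  have "root (N - 1) (bid_ratio b) = c"
    using N assms(3) real_root_power_cancel[of "N - 1" c] by (simp add: assms(5)[symmetric])
  then show ?thesis
    using assms p_star_bounds by (simp add: bid_cdf_def)
qed

lemma win_prob_bid_cdf:
  assumes "0 \<le> b" "b \<le> V - g"
  shows "win_prob (p_star N V g r1, bid_cdf) b = bid_ratio b"
proof -
  have "p_star N V g r1 + (1 - p_star N V g r1) * bid_cdf b = root (N - 1) (bid_ratio b)"
    using assms p_star_bounds by (simp add: bid_cdf_def)
  then show ?thesis
    using N bid_ratio_nonneg[OF assms] by (simp add: win_prob_def)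
qed

text \<open>Bids up to \<open>V - g\<close> break even; higher ones win with probability
  \<open>1\<close> but cost more than \<open>V\<close>. So no deviation earns a positive payoff, and
  the strategy itself earns \<open>0\<close>.\<close>

lemma nash_equilibrium_bid_cdf:
  "nash_equilibrium N V g r1 r2 (\<lambda>_. (p_star N V g r1, bid_cdf))"
proof -
  define t where "t = (p_star N V g r1, bid_cdf)"
  have t: "mixed_strategy t"
    using mixed_strategy_bid_cdf by (simp add: t_def)
  have zero: "bid_payoff t b = 0" if "0 \<le> b" "b \<le> V - g" for b
    using that win_prob_bid_cdf by (simp add: t_def bid_payoff_eq_0_iff)
  have nonpos: "bid_payoff t b \<le> 0" if "0 \<le> b" for b
  proof (cases "b \<le> V - g")
    case False
    then show ?thesis
      by (simp add: bid_payoff_eq win_prob_def t_def bid_cdf_eq_1)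
  qed (use zero that in simp)
  have le: "expected_payoff N V g r1 r2 ((\<lambda>_. t)(i := s)) i \<le> 0"
    if "mixed_strategy s" "i < N" for s i
  proof -
    obtain q H where "s = (q, H)"
      by (cases s)
    with that have s: "s = (q, H)" "mixed_strategy (q, H)"
      by auto
    \<comment> \<open>In the third case participation is possible and the payoff is nonnegative,
      which makes the cost integrable.\<close>
    consider "expected_payoff N V g r1 r2 ((\<lambda>_. t)(i := s)) i \<le> 0" | "q = 1" |
      "q < 1" "0 \<le> expected_payoff N V g r1 r2 ((\<lambda>_. t)(i := s)) i"
      using mixed_strategyD(2)[OF s(2)] by fastforce
    then show ?thesis
    proof cases
      case 2
      then show ?thesis
        using s expected_payoff_abstain[OF t _ that(2)] by simp
    next
      case 3
      then have c: "integrable (interval_measure H) (bid_cost t)"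
        using integrable_bid_cost[OF t s(2) that(2)] s(1) by simp
      have "(\<integral>b. bid_payoff t b \<partial>interval_measure H) \<le> (\<integral>b. 0 \<partial>interval_measure H)"
        using AE_bid_nonneg[OF s(2)]
        by (intro integral_mono_AE expected_payoff_integrable(1)[OF t s(2) that(2) c])
          (auto elim!: eventually_mono intro: nonpos)
      then show ?thesis
        using expected_payoff_integrable(2)[OF t s(2) that(2) c] 3(1) s(1)
        by (simp add: mult_nonneg_nonpos)
    qed
  qed
  have eq: "expected_payoff N V g r1 r2 (\<lambda>_. t) i = 0" if i: "i < N" for i
  proof -
    have s: "mixed_strategy (p_star N V g r1, bid_cdf)"
      using mixed_strategy_bid_cdf .
    interpret prob_space "interval_measure bid_cdf"
      by (rule prob_space_bid[OF s])
    have AE: "AE b in interval_measure bid_cdf. bid_payoff t b = 0"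
      using AE_bid_nonneg[OF s] AE_bid_le[OF s, of "V - g"] bid_cdf_eq_1[of "V - g"]
      by (auto elim!: eventually_elim2 intro: zero)
    then have "AE b in interval_measure bid_cdf. V * win_prob t b = bid_cost t b"
      by eventually_elim (simp add: bid_payoff_def)
    \<comment> \<open>The cost inherits integrability from the bounded function
      \<open>V * win_prob t b\<close>, to which it is almost everywhere equal.\<close>
    then have c: "integrable (interval_measure bid_cdf) (bid_cost t)"
      using integrable_win_prob[OF t s] t by (subst (asm) integrable_cong_AE) auto
    have "(\<integral>b. bid_payoff t b \<partial>interval_measure bid_cdf) = 0"
      using AE t by (subst integral_cong_AE[of _ _ "\<lambda>_. 0"]) auto
    then have "expected_payoff N V g r1 r2 ((\<lambda>_. t)(i := t)) i = 0"
      using expected_payoff_integrable(2)[OF t s i c] by (simp add: t_def zero_ereal_def)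
    then show ?thesis
      by (simp add: const_fun_upd)
  qed
  show ?thesis
    using le eq t unfolding nash_equilibrium_def t_def[symmetric] by simp
qed

text \<open>The value \<open>M\<close> of participating is at most the payoff \<open>(1 - p) * M\<close>, so \<open>M > 0\<close> would
  force \<open>p = 0\<close>; but then the lowest bid never wins and cannot be worth \<open>M\<close>.\<close>

lemma bid_payoff_equilibrium:
  assumes E: "nash_equilibrium N V g r1 r2 (\<lambda>_. (p, F))"
  shows "p < 1" and "0 \<le> b \<Longrightarrow> bid_payoff (p, F) b \<le> 0"
    and "0 \<le> b \<Longrightarrow> F b \<noteq> 1 \<Longrightarrow> bid_payoff (p, F) b = 0"
proof -
  let ?u = "bid_payoff (p, F)"
  let ?P = "\<lambda>s. expected_payoff N V g r1 r2 ((\<lambda>_. (p, F))(0 := s)) 0"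
  have N0: "0 < N"
    using N by simp
  have s: "mixed_strategy (p, F)"
    using E N0 by (auto simp: nash_equilibrium_def)
  note F = mixed_strategyD[OF s]
  interpret prob_space "interval_measure F"
    by (rule prob_space_bid[OF s])
  have best: "?P s' \<le> ?P (p, F)" if "mixed_strategy s'" for s'
    using E N0 that unfolding nash_equilibrium_def const_fun_upd by blast
  have s0: "mixed_strategy (0, F)" and s1: "mixed_strategy (1, F)"
    using s by (auto simp: mixed_strategy_def)
  have nonneg: "0 \<le> ?P (p, F)"
    using best[OF s1] expected_payoff_abstain[OF s s1 N0] by simp
  have u_le_P: "ereal (?u b) \<le> ?P (p, F)" if "0 \<le> b" for b
    using bid_payoff_le_equilibrium_payoff[OF E N0 that] by (simp add: const_fun_upd)
  \<comment> \<open>If everyone abstained, a bid of \<open>0\<close> would win for sure and earn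
    \<open>V - g > 0\<close>.\<close>
  have "p \<noteq> 1"
  proof
    assume p: "p = 1"
    then have "?P (p, F) = 0"
      using expected_payoff_abstain[OF s s1 N0] by simp
    moreover have "?u 0 = V - g"
      by (simp add: bid_payoff_eq win_prob_def p)
    ultimately show False
      using u_le_P[of 0] gV by simp
  qed
  then have p1: "p < 1"
    using F(2) by simp
  define M where "M = (\<integral>b. ?u b \<partial>interval_measure F)"
  note c = integrable_bid_cost[OF s s N0 p1 nonneg]
  have int: "integrable (interval_measure F) ?u"
    by (rule expected_payoff_integrable(1)[OF s s N0 c])
  have P: "?P (p, F) = ereal ((1 - p) * M)" and P0: "?P (0, F) = ereal M"
    using expected_payoff_integrable(2)[OF s s N0 c] expected_payoff_integrable(2)[OF s s0 N0 c]
    by (simp_all add: M_def)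
  have "0 \<le> (1 - p) * M"
    using nonneg P by simp
  then have M0: "0 \<le> M"
    using p1 by (simp add: zero_le_mult_iff)
  have "M \<le> (1 - p) * M"
    using best[OF s0] P P0 by simp
  then have pM: "p * M = 0"
    using mult_nonneg_nonneg[OF F(1) M0] by (simp add: algebra_simps)
  then have "(1 - p) * M = M"
    by (simp add: algebra_simps)
  then have u_le: "?u b \<le> M" if "0 \<le> b" for b
    using u_le_P[OF that] by (simp only: P ereal_less_eq)
  \<comment> \<open>\<open>M\<close> is both an upper bound and the mean of \<open>?u\<close>, so
    the nonnegative difference has integral \<open>0\<close>.\<close>
  have AE_eq: "AE b in interval_measure F. ?u b = M"
  proof -
    have "AE b in interval_measure F. 0 \<le> M - ?u b"
      using AE_bid_nonneg[OF s] by eventually_elim (simp add: u_le)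
    moreover have "(\<integral>b. M - ?u b \<partial>interval_measure F) = 0"
      using int prob_space by (simp add: M_def)
    ultimately have "AE b in interval_measure F. M - ?u b = 0"
      using int by (subst (asm) integral_nonneg_eq_0_iff_AE) auto
    then show ?thesis
      by eventually_elim simp
  qed
  have u_eq: "?u b = M" if "0 \<le> b" "F b \<noteq> 1" for b
    using cdf_eq_1_if_suboptimal[OF s AE_eq that(1)] u_le[OF that(1)] that(2)
    by (metis order_le_imp_less_or_eq)
  have F0: "F 0 = 0"
    by (simp add: mixed_strategy_cdf_nonpos[OF s])
  have W0: "win_prob (p, F) 0 = p ^ (N - 1)"
    by (simp add: win_prob_def F0)
  have "M = 0"
  proof (rule ccontr)
    assume "M \<noteq> 0"
    then have "p = 0"
      using pM by simp
    \<comment> \<open>Since \<open>N - 1\<close> is positive, \<open>0 ^ (N - 1)\<close> is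
      \<open>0\<close> rather than \<open>1\<close>.\<close>
    then have "?u 0 = - (r1 * g)"
      using N W0 by (simp add: bid_payoff_eq power_0_left)
    then show False
      using u_eq[of 0] F0 M0 \<open>M \<noteq> 0\<close> r1 g by (simp add: mult_le_0_iff)
  qed
  show "p < 1"
    by (rule p1)
  show "bid_payoff (p, F) b \<le> 0" if "0 \<le> b"
    using u_le[OF that] \<open>M = 0\<close> by simp
  show "bid_payoff (p, F) b = 0" if "0 \<le> b" "F b \<noteq> 1"
    using u_eq[OF that] \<open>M = 0\<close> by simp
qed

text \<open>Indifference at bid \<open>0\<close>, where \<open>F\<close> vanishes, determines
  \<open>p\<close>; indifference at each bid below \<open>V - g\<close> then determines
  \<open>F\<close> there.\<close>

lemma nash_equilibrium_unique:
  assumes E: "nash_equilibrium N V g r1 r2 (\<lambda>_. (p, F))"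
  shows "(p, F) = (p_star N V g r1, bid_cdf)"
proof -
  let ?u = "bid_payoff (p, F)"
  note p1 = bid_payoff_equilibrium(1)[OF E] and u_le = bid_payoff_equilibrium(2)[OF E]
    and u_eq = bid_payoff_equilibrium(3)[OF E]
  have s: "mixed_strategy (p, F)"
    using E N unfolding nash_equilibrium_def by (meson less_le_trans zero_less_numeral)
  note F = mixed_strategyD[OF s]
  have F0: "F 0 = 0"
    by (simp add: mixed_strategy_cdf_nonpos[OF s])
  then have "p ^ (N - 1) = bid_ratio 0"
    using u_eq[of 0] gV bid_payoff_eq_0_iff[of 0 "(p, F)"] by (simp add: win_prob_def)
  then have p: "p = p_star N V g r1"
    using N F(1) real_root_power_cancel[of "N - 1" p] unfolding p_star_eq_root by simp
  have "F b = bid_cdf b" for b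
  proof -
    consider "b < 0" | "0 \<le> b" "b < V - g" | "V - g \<le> b" by linarith
    then show ?thesis
    proof cases
      case 1
      then show ?thesis
        by (simp only: F(5) mixed_strategyD(5)[OF mixed_strategy_bid_cdf])
    next
      case 2
      \<comment> \<open>Otherwise \<open>b\<close> would win for sure at a positive profit.\<close>
      have "F b \<noteq> 1"
      proof
        assume "F b = 1"
        then have "?u b = V - g - b"
          by (simp add: bid_payoff_eq win_prob_def)
        then show False
          using u_le[of b] 2 by simp
      qed
      then have "win_prob (p, F) b = bid_ratio b"
        using u_eq[of b] 2 by (simp add: bid_payoff_eq_0_iff)
      then have "(p + (1 - p) * F b) ^ (N - 1) = bid_ratio b"
        by (simp add: win_prob_def)
      moreover have "0 \<le> p + (1 - p) * F b"
        using mix_bounds(1)[OF s, of b] by simp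
      ultimately show ?thesis
        using 2 bid_cdf_eqI[of b "p + (1 - p) * F b" "F b"] by (simp only: p less_imp_le)
    next
      case 3
      \<comment> \<open>Winning with a bid of at least \<open>V - g\<close> gains nothing, and
        losing costs a positive penalty. If losing had positive probability, the payoff would be
        negative instead of \<open>0\<close>.\<close>
      have "F b = 1"
      proof (rule ccontr)
        assume "F b \<noteq> 1"
        then have u: "?u b = 0" and "F b < 1"
          using u_eq[of b] 3 gV mixed_strategy_cdf_le_1[OF s, of b] by auto
        then have "(1 - p) * F b < (1 - p) * 1"
          using p1 by (intro mult_strict_left_mono) auto
        then have "p + (1 - p) * F b < 1"
          by simp
        then have W: "win_prob (p, F) b < 1"
          using N mix_bounds(1)[OF s, of b] by (simp add: win_prob_def power_less_one_iff)
        have "0 < r1 * g \<or> 0 < r2 * b"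
          using r1 r2 r12 g gV 3 by auto
        moreover have "0 \<le> r1 * g" "0 \<le> r2 * b"
          using r1 r2 g gV 3 by auto
        ultimately have "0 < r1 * g + r2 * b"
          by linarith
        then have "0 < (1 - win_prob (p, F) b) * (r1 * g + r2 * b)"
          using W by simp
        moreover have "win_prob (p, F) b * (V - g - b) \<le> 0"
          using win_prob_bounds[OF s, of b] 3 by (simp add: mult_nonneg_nonpos)
        ultimately show False
          using u by (simp add: bid_payoff_eq)
      qed
      then show ?thesis
        using bid_cdf_eq_1[OF 3] by simp
    qed
  qed
  then have "F = bid_cdf"
    by (rule ext)
  with p show ?thesis
    by (rule arg_cong2[where f = Pair])
qed

lemma equilibrium_strategy_eq: "equilibrium_strategy N V g r1 r2 = (p_star N V g r1, bid_cdf)"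
  unfolding equilibrium_strategy_def
proof (rule the_equality)
  show "s = (p_star N V g r1, bid_cdf)" if "nash_equilibrium N V g r1 r2 (\<lambda>_. s)" for s
    using that nash_equilibrium_unique by (cases s) blast
qed (rule nash_equilibrium_bid_cdf)

lemma expected_submitted_eq:
  "expected_submitted N V g r1 r2 = (1 - p_star N V g r1) * real N"
  unfolding expected_submitted_def equilibrium_strategy_eq
  by (rule expectation_submitted_txs[OF mixed_strategy_bid_cdf])

end

section \<open>Dependence on the parameters\<close>

text \<open>The base \<open>x * g / (V - g + x * g)\<close> increases strictly because
  \<open>V - g\<close> is positive, and the exponent \<open>1 / (N - 1)\<close> is positive.\<close>

lemma p_star_strict_mono:
  assumes "N \<ge> 2" "0 < g" "g < V" "0 \<le> x" "x < y"
  shows "p_star N V g x < p_star N V g y"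
proof -
  have "x * g * (V - g) < y * g * (V - g)"
    using assms by simp
  then have "x * g / (V - g + x * g) < y * g / (V - g + y * g)"
    using assms by (subst divide_add_self_less_iff) (auto intro: add_pos_nonneg)
  then show ?thesis
    unfolding p_star_def using assms
    by (intro powr_less_mono2) auto
qed

theorem theorem4p2:
  fixes N :: nat and V g r1 r2 :: real
  assumes "N \<ge> 2" and "0 < g" and "g < V"
    and "r1 \<in> {0..1}" and "r2 \<in> {0..1}" and "r1 \<noteq> 0 \<or> r2 \<noteq> 0"
  shows
    "(expected_submitted N V g r1 r2 = (1 - p_star N V g r1) * real N \<and>
      (1 - p_star N V g r1) * real N =
        (1 - (r1 * g / (V - g + r1 * g)) powr (1 / (real N - 1))) * real N) \<and>
     (strict_antimono_on {x \<in> {0..1}. x \<noteq> 0 \<or> r2 \<noteq> 0} (\<lambda>x. expected_submitted N V g x r2) \<and>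
      (\<forall>y\<in>{0..1}. r1 \<noteq> 0 \<or> y \<noteq> 0 \<longrightarrow>
         expected_submitted N V g r1 y = expected_submitted N V g r1 r2)) \<and>
     (r1 \<noteq> 0 \<longrightarrow>
      (\<lambda>n. expected_submitted n V g r1 r2) \<longlonglongrightarrow> ln (1 + (V - g) / (r1 * g)))"
proof -
  \<comment> \<open>Kept general in \<open>n\<close>, \<open>x\<close> and \<open>y\<close>: the
    limit varies the number of agents, and the two claims of part (2) vary the rates.\<close>
  have formula: "expected_submitted n V g x y = (1 - p_star n V g x) * real n"
    if "n \<ge> 2" "x \<in> {0..1}" "y \<in> {0..1}" "x \<noteq> 0 \<or> y \<noteq> 0" for n x y
  proof -
    interpret auction n V g x y
      using assms that by unfold_locales auto
    show ?thesis
      by (rule expected_submitted_eq)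
  qed
  have "strict_antimono_on {x \<in> {0..1}. x \<noteq> 0 \<or> r2 \<noteq> 0} (\<lambda>x. expected_submitted N V g x r2)"
  proof (rule monotone_onI)
    fix x y :: real
    assume "x \<in> {x \<in> {0..1}. x \<noteq> 0 \<or> r2 \<noteq> 0}" "y \<in> {x \<in> {0..1}. x \<noteq> 0 \<or> r2 \<noteq> 0}" "x < y"
    then show "expected_submitted N V g y r2 < expected_submitted N V g x r2"
      using assms p_star_strict_mono[of N g V x y] by (simp add: formula)
  qed
  moreover have "(\<lambda>n. expected_submitted n V g r1 r2) \<longlonglongrightarrow> ln (1 + (V - g) / (r1 * g))"
    if "r1 \<noteq> 0"
  proof -
    have pos: "0 < r1 * g" "0 < V - g + r1 * g"
      using assms that by (auto intro: add_pos_pos)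
    \<comment> \<open>The base of \<open>p_star\<close> is free of \<open>n\<close>, and its inverse
      is the argument of the limiting logarithm.\<close>
    define x where "x = r1 * g / (V - g + r1 * g)"
    have x: "0 < x" "1 + (V - g) / (r1 * g) = inverse x"
      using pos by (auto simp: x_def divide_simps)
    have "\<forall>\<^sub>F n in sequentially.
        (1 - x powr (1 / (real n - 1))) * real n = expected_submitted n V g r1 r2"
      using eventually_ge_at_top[of 2]
      by eventually_elim (use assms in \<open>simp add: formula p_star_def x_def\<close>)
    then show ?thesis
      using tendsto_one_minus_powr_mult[OF x(1)] x by (simp add: ln_inverse Lim_transform_eventually)
  qed
  moreover have "expected_submitted N V g r1 r2 = (1 - p_star N V g r1) * real N"
    by (rule formula) (use assms in auto)
  moreover have "expected_submitted N V g r1 y = expected_submitted N V g r1 r2"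
    if "y \<in> {0..1}" "r1 \<noteq> 0 \<or> y \<noteq> 0" for y
    using assms that by (simp only: formula)
  moreover note p_star_def[of N V g r1]
  ultimately show ?thesis
    by presburger
qed

end
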